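(* Let $\pi\in\mathfrak{B}_n$, write $d=\operatorname{des}_B(\pi)$, $e=\operatorname{ides}_B(\pi)$, and let $n(\pi)$ be the number of negative entries among $\pi_1,\dots,\pi_n$. Among the grid points $(i,j)$, $1\le i,j\le n+1$, of $P_\pi$, with $d$-types taken with respect to the $r$-order, the number with $d^+$-type $(0,0)$, $(1,0)$, $(0,1)$, $(1,1)$ is respectively $(d+1)(e+1)-n(\pi)+n$, $(e+1)(n-d)+n(\pi)-n$, $(d+1)(n-e)+n(\pi)-n$, $(n-d)(n-e)-n(\pi)+n$; and the number with $d^-$-type $(0,0)$, $(1,0)$, $(0,1)$, $(1,1)$ is respectively $de+n(\pi)$, $e(n-d+1)-n(\pi)$, $d(n-e+1)-n(\pi)$, $(n-d+1)(n-e+1)+n(\pi)$.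
   Context: $\mathfrak{B}_n$ is the set of signed permutations $\pi=\pi_1\cdots\pi_n$ ($\pi_i\in\{\pm1,\dots,\pm n\}$, $|\pi_1|,\dots,|\pi_n|$ a permutation of $[n]$), $\pi_0=0$, inverse given by $\pi^{-1}_{|\pi_i|}=\operatorname{sgn}(\pi_i)\,i$. The $r$-order on $\mathbb{Z}$ is $-1<_r-2<_r-3<_r\cdots<_r0<_r1<_r2<_r\cdots$; $\operatorname{des}_B(\pi)=|\{i\in\{0,\dots,n-1\}:\pi_i>_r\pi_{i+1}\}|$, $\operatorname{ides}_B(\pi)=\operatorname{des}_B(\pi^{-1})$. Grid points $(i,j)$, $1\le i,j\le n+1$, of the $n\times n$ grid $P_\pi$ are intersections of the $i$-th horizontal (from top) and $j$-th vertical (from left) grid lines. For $i,j\in[n+1]$, $\varphi_{(i,j)}(\pi)$ is the $\sigma\in\mathfrak{B}_{n+1}$ with $\sigma_i=j$, $\sigma_k=s(\pi_k)$ for $k<i$, $\sigma_k=s(\pi_{k-1})$ for $k>i$, where $s(x)=x$ if $|x|<j$, $s(x)=x+1$ if $x\ge j$, $s(x)=x-1$ if $x\le-j$; $\overline{\varphi}_{(i,j)}(\pi)$ is the same with $\sigma_i=-j$. $d^+(i,j)=\big(\operatorname{des}_B(\varphi_{(i,j)}(\pi))-\operatorname{des}_B(\pi),\ \operatorname{ides}_B(\varphi_{(i,j)}(\pi))-\operatorname{ides}_B(\pi)\big)$, and $d^-(i,j)$ is the same with $\overline{\varphi}_{(i,j)}$. *)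

theory Defs
  imports Main
begin

text \<open>
  A signed permutation \<open>\<pi>\<^sub>1 \<dots> \<pi>\<^sub>n\<close> is represented by a function on \<open>nat\<close> that vanishes outside
  \<open>{1..n}\<close>. In particular \<open>\<pi> 0 = 0\<close>, and distinct signed permutations are distinct functions.
\<close>

definition signed_perms :: "nat \<Rightarrow> (nat \<Rightarrow> int) set" where
  "signed_perms n =
    {\<pi>. bij_betw (\<lambda>i. nat \<bar>\<pi> i\<bar>) {1..n} {1..n} \<and> (\<forall>i. i \<notin> {1..n} \<longrightarrow> \<pi> i = 0)}"

definition sp_inverse :: "nat \<Rightarrow> (nat \<Rightarrow> int) \<Rightarrow> nat \<Rightarrow> int" where
  "sp_inverse n \<pi> m =
    (if m \<in> {1..n}
     then let i = inv_into {1..n} (\<lambda>k. nat \<bar>\<pi> k\<bar>) m in sgn (\<pi> i) * int i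
     else 0)"

text \<open>The \<open>r\<close>-order on the integers: \<open>-1 < -2 < -3 < \<dots> < 0 < 1 < 2 < \<dots>\<close>.\<close>

definition r_less :: "int \<Rightarrow> int \<Rightarrow> bool"  (infix "<\<^sub>r" 50) where
  "x <\<^sub>r y \<longleftrightarrow> (if x < 0 \<and> y < 0 then y < x else x < y)"

definition des_B :: "nat \<Rightarrow> (nat \<Rightarrow> int) \<Rightarrow> nat" where
  "des_B n \<pi> = card {i \<in> {0..<n}. \<pi> (i + 1) <\<^sub>r \<pi> i}"

definition ides_B :: "nat \<Rightarrow> (nat \<Rightarrow> int) \<Rightarrow> nat" where
  "ides_B n \<pi> = des_B n (sp_inverse n \<pi>)"

definition neg_count :: "nat \<Rightarrow> (nat \<Rightarrow> int) \<Rightarrow> nat" where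
  "neg_count n \<pi> = card {i \<in> {1..n}. \<pi> i < 0}"

definition grid_points :: "nat \<Rightarrow> (nat \<times> nat) set" where
  "grid_points n = {1..n + 1} \<times> {1..n + 1}"

definition shift_entry :: "nat \<Rightarrow> int \<Rightarrow> int" where
  "shift_entry j x =
    (if \<bar>x\<bar> < int j then x else if x \<ge> int j then x + 1 else x - 1)"

text \<open>For \<open>i, j \<ge> 1\<close> the value at position \<open>0\<close> and the values beyond position \<open>n + 1\<close> remain \<open>0\<close>.\<close>

definition phi :: "nat \<times> nat \<Rightarrow> (nat \<Rightarrow> int) \<Rightarrow> nat \<Rightarrow> int" where
  "phi = (\<lambda>(i, j) \<pi> k.
    if k < i then shift_entry j (\<pi> k)
    else if k = i then int j
    else shift_entry j (\<pi> (k - 1)))"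

definition phi_bar :: "nat \<times> nat \<Rightarrow> (nat \<Rightarrow> int) \<Rightarrow> nat \<Rightarrow> int" where
  "phi_bar = (\<lambda>(i, j) \<pi> k.
    if k < i then shift_entry j (\<pi> k)
    else if k = i then - int j
    else shift_entry j (\<pi> (k - 1)))"

definition d_plus :: "nat \<Rightarrow> (nat \<Rightarrow> int) \<Rightarrow> nat \<times> nat \<Rightarrow> int \<times> int" where
  "d_plus n \<pi> p =
    (int (des_B (n + 1) (phi p \<pi>)) - int (des_B n \<pi>),
     int (ides_B (n + 1) (phi p \<pi>)) - int (ides_B n \<pi>))"

definition d_minus :: "nat \<Rightarrow> (nat \<Rightarrow> int) \<Rightarrow> nat \<times> nat \<Rightarrow> int \<times> int" where
  "d_minus n \<pi> p =
    (int (des_B (n + 1) (phi_bar p \<pi>)) - int (des_B n \<pi>),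
     int (ides_B (n + 1) (phi_bar p \<pi>)) - int (ides_B n \<pi>))"

lemma sp_inverse_apply:
  assumes "\<pi> \<in> signed_perms n" "i \<in> {1..n}"
  shows "sp_inverse n \<pi> (nat \<bar>\<pi> i\<bar>) = sgn (\<pi> i) * int i"
proof -
  have b: "bij_betw (\<lambda>k. nat \<bar>\<pi> k\<bar>) {1..n} {1..n}"
    using assms(1) by (simp add: signed_perms_def)
  have "nat \<bar>\<pi> i\<bar> \<in> {1..n}"
    using bij_betw_apply[OF b assms(2)] .
  moreover have "inv_into {1..n} (\<lambda>k. nat \<bar>\<pi> k\<bar>) (nat \<bar>\<pi> i\<bar>) = i"
    using bij_betw_inv_into_left[OF b assms(2)] .
  ultimately show ?thesis
    by (simp only: sp_inverse_def Let_def if_True)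
qed

end

theory Submission
  imports Defs
begin

text \<open>
  Inserting an entry \<open>c j\<close> with sign \<open>c\<close> at position \<open>i\<close> changes the descent number by
  \<open>C i + w i j - w (i - 1) j\<close>, where \<open>C i\<close> marks the non-descents and \<open>w i j\<close> compares the
  inserted entry with \<open>\<pi> i\<close>. As insertion at \<open>(i, j)\<close> into \<open>\<pi>\<close> is insertion at \<open>(j, i)\<close> into
  the inverse, the change of the inverse descent number is \<open>E j + z j i - z (j - 1) i\<close>,
  with \<open>E\<close> and \<open>z\<close> formed from the inverse. The differences telescope along rows and columns, so in the sum of the products of the two changes
  only \<open>(\<Sum>i. C i) * (\<Sum>j. E j)\<close> and the correlation of the two differences survive. Both
  \<open>w i (j + 1) - w i j\<close> and \<open>z j (i + 1) - z j i\<close> are the indicator of \<open>\<pi> i = c j\<close>, so two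
  summations by parts show that the correlation is the number of entries of sign \<open>c\<close>. The changes
  are 0 or 1, so this sum and the two marginal sums determine all four counts.
\<close>

section \<open>Insertion of an entry of either sign\<close>

definition signed_insert :: "int \<Rightarrow> nat \<Rightarrow> nat \<Rightarrow> (nat \<Rightarrow> int) \<Rightarrow> nat \<Rightarrow> int" where
  "signed_insert c i j \<pi> k =
    (if k < i then shift_entry j (\<pi> k)
     else if k = i then c * int j
     else shift_entry j (\<pi> (k - 1)))"

lemma phi_eq_signed_insert: "phi (i, j) \<pi> = signed_insert 1 i j \<pi>"
  by (auto simp: phi_def signed_insert_def)

lemma phi_bar_eq_signed_insert: "phi_bar (i, j) \<pi> = signed_insert (-1) i j \<pi>"
  by (auto simp: phi_bar_def signed_insert_def)

section \<open>Signed permutations and their inverses\<close>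

lemma signed_perms_abs_mem:
  assumes "\<pi> \<in> signed_perms n" "i \<in> {1..n}"
  shows "nat \<bar>\<pi> i\<bar> \<in> {1..n}"
  using assms bij_betw_apply[of "\<lambda>i. nat \<bar>\<pi> i\<bar>" "{1..n}" "{1..n}"]
  by (auto simp: signed_perms_def)

lemma signed_perms_outside:
  assumes "\<pi> \<in> signed_perms n" "i \<notin> {1..n}"
  shows "\<pi> i = 0"
  using assms by (simp add: signed_perms_def)

lemma signed_perms_obtain:
  assumes "\<pi> \<in> signed_perms n" "j \<in> {1..n}"
  obtains i where "i \<in> {1..n}" "nat \<bar>\<pi> i\<bar> = j"
proof -
  have "j \<in> (\<lambda>i. nat \<bar>\<pi> i\<bar>) ` {1..n}"
    using assms by (auto simp: signed_perms_def bij_betw_def)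
  then show thesis using that by auto
qed

lemma sp_inverse_outside: "i \<notin> {1..n} \<Longrightarrow> sp_inverse n \<pi> i = 0"
  by (simp only: sp_inverse_def if_False)

text \<open>Inversion exchanges position and absolute value and keeps the sign. This identifies the
  increments of the weights of \<pi> with those of its inverse. For \<open>j > n\<close> both sides
  are false, so the boundary value \<open>j = n + 1\<close> is covered.\<close>

lemma sp_inverse_eq_iff:
  assumes \<pi>: "\<pi> \<in> signed_perms n" and c: "c = 1 \<or> c = -1" and ij: "i \<in> {1..n}" "j \<ge> 1"
  shows "sp_inverse n \<pi> j = c * int i \<longleftrightarrow> \<pi> i = c * int j"
proof
  assume "\<pi> i = c * int j"
  moreover from this have "nat \<bar>\<pi> i\<bar> = j" using c by auto
  ultimately show "sp_inverse n \<pi> j = c * int i"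
    using sp_inverse_apply[OF \<pi> ij(1)] c ij(2) by (auto simp: sgn_if)
next
  assume inv: "sp_inverse n \<pi> j = c * int i"
  then have "j \<in> {1..n}" using sp_inverse_outside c ij by fastforce
  then obtain k where k: "k \<in> {1..n}" "nat \<bar>\<pi> k\<bar> = j" using signed_perms_obtain[OF \<pi>] by blast
  then have "sgn (\<pi> k) * int k = c * int i" using sp_inverse_apply[OF \<pi> k(1)] inv by simp
  then have "i = k \<and> sgn (\<pi> k) = c" using c k ij by (auto simp: sgn_if split: if_splits)
  then show "\<pi> i = c * int j" using k by (auto simp: sgn_if split: if_splits)
qed

text \<open>Entries at positions in \<open>{1..n}\<close> are nonzero, so their signs have absolute
  value 1 and the absolute values of the inverse form the inverse bijection of
  \<open>?f\<close>.\<close>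

lemma sp_inverse_signed_perms:
  assumes \<pi>: "\<pi> \<in> signed_perms n"
  shows "sp_inverse n \<pi> \<in> signed_perms n"
proof -
  let ?f = "\<lambda>k. nat \<bar>\<pi> k\<bar>"
  have b: "bij_betw ?f {1..n} {1..n}" using \<pi> by (simp add: signed_perms_def)
  have "nat \<bar>sp_inverse n \<pi> j\<bar> = inv_into {1..n} ?f j" if j: "j \<in> {1..n}" for j
  proof -
    obtain i where i: "i \<in> {1..n}" "nat \<bar>\<pi> i\<bar> = j" using signed_perms_obtain[OF \<pi> j] .
    then have "inv_into {1..n} ?f j = i" using bij_betw_inv_into_left[OF b] by auto
    moreover have "sp_inverse n \<pi> j = sgn (\<pi> i) * int i" using sp_inverse_apply[OF \<pi> i(1)] i by simp
    moreover have "\<pi> i \<noteq> 0" using i j by auto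
    ultimately show ?thesis by (auto simp: abs_mult sgn_if)
  qed
  then have "bij_betw (\<lambda>j. nat \<bar>sp_inverse n \<pi> j\<bar>) {1..n} {1..n}"
    using bij_betw_inv_into[OF b] by (subst bij_betw_cong)
  then show ?thesis by (simp add: signed_perms_def sp_inverse_outside)
qed

section \<open>Insertion commutes with inversion up to transposition\<close>

lemma abs_shift_entry:
  "nat \<bar>shift_entry j x\<bar> = (if nat \<bar>x\<bar> < j then nat \<bar>x\<bar> else nat \<bar>x\<bar> + 1)"
  by (auto simp: shift_entry_def)

lemma sgn_shift_entry: "j \<ge> 1 \<Longrightarrow> sgn (shift_entry j x) = sgn x"
  by (auto simp: shift_entry_def sgn_if)

text \<open>Only surjectivity of the absolute values needs an argument: a map from a finite set onto
  itself is injective.\<close>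

lemma signed_insert_signed_perms:
  assumes \<pi>: "\<pi> \<in> signed_perms n" and c: "c = 1 \<or> c = -1"
    and i: "i \<in> {1..n+1}" and j: "j \<in> {1..n+1}"
  shows "signed_insert c i j \<pi> \<in> signed_perms (n + 1)"
proof -
  let ?f = "\<lambda>k. nat \<bar>signed_insert c i j \<pi> k\<bar>"
  let ?s = "\<lambda>t. if t < j then t else t + 1"
  have f: "?f k = (if k < i then ?s (nat \<bar>\<pi> k\<bar>) else if k = i then j else ?s (nat \<bar>\<pi> (k - 1)\<bar>))"
    for k
    using c by (auto simp: signed_insert_def abs_shift_entry abs_mult)
  have "{1..n+1} \<subseteq> ?f ` {1..n+1}"
  proof
    fix m assume m: "m \<in> {1..n+1}"
    show "m \<in> ?f ` {1..n+1}"
    proof (cases "m = j")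
      case True
      then have "m = ?f i" by (simp add: f)
      then show ?thesis using i by blast
    next
      case False
      \<comment> \<open>The shift skips exactly the value \<open>j\<close>; \<open>t\<close> is the
        absolute value that it sends to \<open>m\<close>.\<close>
      define t where "t = (if m < j then m else m - 1)"
      have "t \<in> {1..n}" using False m j by (auto simp: t_def)
      then obtain k where k: "k \<in> {1..n}" "nat \<bar>\<pi> k\<bar> = t" using signed_perms_obtain[OF \<pi>] by blast
      have "m = ?s t" using False m by (auto simp: t_def)
      then have "m = ?f (if k < i then k else k + 1)" using k by (simp add: f)
      moreover have "(if k < i then k else k + 1) \<in> {1..n+1}" using k by auto
      ultimately show ?thesis by blast
    qed
  qed
  moreover have "card (?f ` {1..n+1}) \<le> card {1..n+1}" by (rule card_image_le) simp
  ultimately have eq: "?f ` {1..n+1} = {1..n+1}"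
    by (metis card_seteq finite_atLeastAtMost finite_imageI)
  then have "inj_on ?f {1..n+1}" by (intro eq_card_imp_inj_on) simp_all
  with eq have "bij_betw ?f {1..n+1} {1..n+1}" by (simp add: bij_betw_def)
  moreover have "signed_insert c i j \<pi> k = 0" if "k \<notin> {1..n+1}" for k
  proof -
    have "k < i \<and> \<pi> k = 0 \<or> k > i \<and> \<pi> (k - 1) = 0"
    proof (cases "k = 0")
      case True
      then show ?thesis using i signed_perms_outside[OF \<pi>, of 0] by simp
    next
      case False
      then have "k > i" "k - 1 \<notin> {1..n}" using that i by auto
      then show ?thesis using signed_perms_outside[OF \<pi>] by blast
    qed
    then show ?thesis using j by (auto simp: signed_insert_def shift_entry_def)
  qed
  ultimately show ?thesis by (simp add: signed_perms_def)
qed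

text \<open>Inversion transposes the grid, hence moves the inserted point from \<open>(i, j)\<close>
  to \<open>(j, i)\<close> with the same sign. Thus every statement about descents yields one about
  inverse descents.\<close>

lemma sp_inverse_signed_insert:
  assumes \<pi>: "\<pi> \<in> signed_perms n" and c: "c = 1 \<or> c = -1"
    and i: "i \<in> {1..n+1}" and j: "j \<in> {1..n+1}"
  shows "sp_inverse (n + 1) (signed_insert c i j \<pi>) = signed_insert c j i (sp_inverse n \<pi>)"
proof
  fix m
  let ?\<sigma> = "signed_insert c i j \<pi>"
  have \<sigma>: "?\<sigma> \<in> signed_perms (n + 1)" by (rule signed_insert_signed_perms) fact+
  show "sp_inverse (n + 1) ?\<sigma> m = signed_insert c j i (sp_inverse n \<pi>) m"
  proof (cases "m \<in> {1..n+1}")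
    case False
    have "signed_insert c j i (sp_inverse n \<pi>) \<in> signed_perms (n + 1)"
      by (intro signed_insert_signed_perms sp_inverse_signed_perms) fact+
    from signed_perms_outside[OF this False] sp_inverse_outside[OF False] show ?thesis by simp
  next
    case True
    then obtain k where k: "k \<in> {1..n+1}" and m: "nat \<bar>?\<sigma> k\<bar> = m"
      using signed_perms_obtain[OF \<sigma>] by blast
    have inv: "sp_inverse (n + 1) ?\<sigma> m = sgn (?\<sigma> k) * int k"
      using sp_inverse_apply[OF \<sigma> k] m by simp
    show ?thesis
    proof (cases "k = i")
      case True
      then have "m = j" "?\<sigma> k = c * int j" using m c by (auto simp: signed_insert_def abs_mult)
      then show ?thesis using inv True c j by (auto simp: signed_insert_def sgn_if)
    next
      case False
      \<comment> \<open>Entry \<open>k\<close> of \<open>?\<sigma>\<close> comes from entry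
        \<open>l\<close> of \<pi>, whose absolute value before the shift is
        \<open>t\<close>.\<close>
      define l where "l = (if k < i then k else k - 1)"
      have l: "l \<in> {1..n}" using False k i by (auto simp: l_def)
      have \<sigma>k: "?\<sigma> k = shift_entry j (\<pi> l)" using False by (auto simp: signed_insert_def l_def)
      define t where "t = nat \<bar>\<pi> l\<bar>"
      have t: "t \<in> {1..n}" using signed_perms_abs_mem[OF \<pi> l] by (simp add: t_def)
      have mt: "m = (if t < j then t else t + 1)"
        using m unfolding \<sigma>k abs_shift_entry t_def by (rule sym)
      have "signed_insert c j i (sp_inverse n \<pi>) m = shift_entry i (sp_inverse n \<pi> t)"
        using mt by (auto simp: signed_insert_def)
      also have "\<dots> = shift_entry i (sgn (\<pi> l) * int l)"
        using sp_inverse_apply[OF \<pi> l] by (simp add: t_def)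
      \<comment> \<open>As \<open>k\<close> differs from \<open>i\<close>, shifting the position
        \<open>l\<close> at \<open>i\<close> gives back \<open>k\<close>.\<close>
      also have "\<dots> = sgn (\<pi> l) * int k"
        using False k i t by (auto simp: shift_entry_def l_def t_def sgn_if)
      also have "sgn (\<pi> l) = sgn (?\<sigma> k)" using j by (simp add: \<sigma>k sgn_shift_entry)
      finally show ?thesis using inv by simp
    qed
  qed
qed

section \<open>Change of the descent number under an insertion\<close>

text \<open>The shift keeps signs and is strictly increasing on absolute values, and these determine
  the r-order. So pairs of old neighbours that stay adjacent keep their descents.\<close>

lemma shift_entry_r_less: "j \<ge> 1 \<Longrightarrow> shift_entry j x <\<^sub>r shift_entry j y \<longleftrightarrow> x <\<^sub>r y"
  by (auto simp: shift_entry_def r_less_def)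

lemma des_B_eq_sum: "int (des_B n \<pi>) = (\<Sum>k=1..n. of_bool (\<pi> k <\<^sub>r \<pi> (k - 1)))"
proof -
  have "int (des_B n \<pi>) = (\<Sum>k\<in>{0..<n}. of_bool (\<pi> (k + 1) <\<^sub>r \<pi> k))"
    by (simp add: des_B_def Int_def)
  also have "\<dots> = (\<Sum>k=1..n. of_bool (\<pi> k <\<^sub>r \<pi> (k - 1)))"
    by (rule sum.reindex_bij_witness[of _ "\<lambda>k. k - 1" "\<lambda>k. k + 1"]) auto
  finally show ?thesis .
qed

text \<open>The part of the change that does not depend on \<open>j\<close>. For
  \<open>i \<le> n\<close> the two new pairs contribute the constants
  \<open>of_bool (c = -1)\<close> and \<open>of_bool (c = 1)\<close>, together 1, and the broken
  pair is subtracted. At \<open>i = n + 1\<close> there is only a left neighbour, which leaves the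
  first constant.\<close>

definition ascent :: "int \<Rightarrow> nat \<Rightarrow> (nat \<Rightarrow> int) \<Rightarrow> nat \<Rightarrow> int" where
  "ascent c n \<pi> i = (if i \<le> n then of_bool (\<not> \<pi> i <\<^sub>r \<pi> (i - 1)) else of_bool (c = -1))"

text \<open>
  Up to a constant, \<open>weight c j x\<close> indicates that the inserted entry \<open>c j\<close> lies above the (shifted)
  entry \<open>x\<close>. The constant is chosen to make the weight of \<open>x = 0\<close> vanish, so that the sums below
  have no boundary terms.
\<close>

definition weight :: "int \<Rightarrow> nat \<Rightarrow> int \<Rightarrow> int" where
  "weight c j x = (if c = 1 then - of_bool (int j \<le> x) else of_bool (- int j < x \<and> x < 0))"

definition des_change :: "int \<Rightarrow> nat \<Rightarrow> (nat \<Rightarrow> int) \<Rightarrow> nat \<Rightarrow> nat \<Rightarrow> int" where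
  "des_change c n \<pi> i j = ascent c n \<pi> i + weight c j (\<pi> i) - weight c j (\<pi> (i - 1))"

lemma weight_0: "j \<ge> 1 \<Longrightarrow> weight c j 0 = 0"
  by (simp add: weight_def)

text \<open>Replacing \<open>j\<close> by \<open>j + 1\<close> moves the inserted entry upwards past
  the value \<open>c * int j\<close> and no other. In the r-order the move is upwards for negative
  entries too, so the increment has the same sign in both cases.\<close>

lemma weight_Suc_diff:
  assumes "c = 1 \<or> c = -1" "j \<ge> 1"
  shows "weight c (Suc j) x - weight c j x = of_bool (x = c * int j)"
  using assms by (auto simp: weight_def of_bool_def)

text \<open>The shift leaves the absolute value \<open>j\<close> free, so the inserted entry never
  equals a shifted one. Exactly one of the two comparisons, this one and its converse,
  holds.\<close>

lemma weight_less_shift: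
  assumes "c = 1 \<or> c = -1" "j \<ge> 1"
  shows "of_bool (c * int j <\<^sub>r shift_entry j x) = of_bool (c = -1) - weight c j x"
  using assms by (auto simp: weight_def shift_entry_def r_less_def)

lemma weight_shift_less:
  assumes "c = 1 \<or> c = -1" "j \<ge> 1"
  shows "of_bool (shift_entry j x <\<^sub>r c * int j) = of_bool (c = 1) + weight c j x"
  using assms by (auto simp: weight_def shift_entry_def r_less_def)

text \<open>With pairs indexed by their right ends, those ending before \<open>i\<close> stay and
  those ending after \<open>i\<close> move one place. Only the pair ending at \<open>i\<close> is
  broken up, into the pairs ending at \<open>i\<close> and \<open>i + 1\<close>.\<close>

lemma des_B_signed_insert:
  assumes \<pi>: "\<pi> \<in> signed_perms n" and c: "c = 1 \<or> c = -1"
    and i: "i \<in> {1..n+1}" and j: "j \<ge> 1"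
  shows "int (des_B (n + 1) (signed_insert c i j \<pi>)) - int (des_B n \<pi>) = des_change c n \<pi> i j"
proof -
  let ?\<sigma> = "signed_insert c i j \<pi>"
  let ?D = "\<lambda>k. of_bool (\<pi> k <\<^sub>r \<pi> (k - 1)) :: int"
  let ?D' = "\<lambda>k. of_bool (?\<sigma> k <\<^sub>r ?\<sigma> (k - 1)) :: int"
  have split: "sum f {1..m} = sum f {1..<i} + sum f {i..m}" if "i \<le> m" for m and f :: "nat \<Rightarrow> int"
  proof -
    have "{1..m} = {1..<i} \<union> {i..m}" using that i by auto
    moreover have "{1..<i} \<inter> {i..m} = {}" by auto
    ultimately show ?thesis by (simp only: sum.union_disjoint finite_atLeastAtMost finite_atLeastLessThan)
  qed
  have "sum ?D' {1..n+1} = sum ?D' {1..<i} + sum ?D' {i..n+1}"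
    using i by (intro split) simp
  also have "sum ?D' {i..n+1} = ?D' i + sum ?D' {Suc i..n+1}"
    using i by (intro sum.atLeast_Suc_atMost) simp
  also have "sum ?D' {1..<i} = sum ?D {1..<i}"
    using i j by (intro sum.cong) (auto simp: signed_insert_def shift_entry_r_less)
  also have "?D' i = of_bool (c = -1) - weight c j (\<pi> (i - 1))"
    using i weight_less_shift[OF c j] by (simp add: signed_insert_def)
  finally have new: "sum ?D' {1..n+1} =
      sum ?D {1..<i} + (of_bool (c = -1) - weight c j (\<pi> (i - 1)) + sum ?D' {Suc i..n+1})" .
  show ?thesis
  proof (cases "i = n + 1")
    case True
    \<comment> \<open>The missing right neighbour is represented by the value 0, whose weight
      vanishes.\<close>
    have "\<pi> (n + 1) = 0" using signed_perms_outside[OF \<pi>] by simp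
    moreover have "{1..<n+1} = {1..n}" by auto
    ultimately show ?thesis
      using new True j unfolding des_B_eq_sum by (simp add: des_change_def ascent_def weight_0)
  next
    case False
    then have in': "i \<le> n" using i by simp
    have "sum ?D' {Suc i..n+1} = ?D' (Suc i) + sum ?D' {Suc (Suc i)..n+1}"
      using in' by (intro sum.atLeast_Suc_atMost) simp
    also have "?D' (Suc i) = of_bool (c = 1) + weight c j (\<pi> i)"
      using weight_shift_less[OF c j] by (simp add: signed_insert_def)
    also have "sum ?D' {Suc (Suc i)..n+1} = sum ?D {Suc i..n}"
      using j
      by (intro sum.reindex_bij_witness[of _ "\<lambda>k. k + 1" "\<lambda>k. k - 1"])
         (auto simp: signed_insert_def shift_entry_r_less)
    finally have right: "sum ?D' {Suc i..n+1} =
      of_bool (c = 1) + weight c j (\<pi> i) + sum ?D {Suc i..n}" .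
    have "sum ?D {1..n} = sum ?D {1..<i} + sum ?D {i..n}"
      using in' by (rule split)
    also have "sum ?D {i..n} = ?D i + sum ?D {Suc i..n}"
      using in' by (intro sum.atLeast_Suc_atMost) simp
    finally show ?thesis
      using new right in' c unfolding des_B_eq_sum by (auto simp: des_change_def ascent_def)
  qed
qed

text \<open>In a linear order, if both new pairs are descents then so was the old pair, and if the
  old pair was a descent then so is at least one new pair. At the right end a single pair is
  added.\<close>

lemma des_change_0_or_1:
  assumes \<pi>: "\<pi> \<in> signed_perms n" and c: "c = 1 \<or> c = -1" and i: "i \<in> {1..n+1}" and j: "j \<ge> 1"
  shows "des_change c n \<pi> i j \<in> {0, 1}"
proof (cases "i = n + 1")
  case True
  then have "\<pi> i = 0" using signed_perms_outside[OF \<pi>] by simp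
  then show ?thesis using True c j by (auto simp: des_change_def ascent_def weight_def)
next
  case False
  then show ?thesis
    using i c by (auto simp: des_change_def ascent_def weight_def r_less_def)
qed

section \<open>Telescoping and summation by parts\<close>

lemma sum_diff_telescope:
  fixes f :: "nat \<Rightarrow> int"
  shows "(\<Sum>i=1..n. f i - f (i - 1)) = f n - f 0"
  by (induction n) auto

lemma summation_by_parts:
  fixes f g :: "nat \<Rightarrow> int"
  shows "(\<Sum>i=1..n+1. (f i - f (i - 1)) * g i) =
    f (n + 1) * g (n + 1) - f 0 * g 1 - (\<Sum>i=1..n. f i * (g (i + 1) - g i))"
  by (induction n) (auto simp: algebra_simps)

lemma sum_ascent:
  "(\<Sum>i=1..n+1. ascent c n \<pi> i) = int n - int (des_B n \<pi>) + of_bool (c = -1)"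
proof -
  have "(\<Sum>i=1..n. ascent c n \<pi> i) = (\<Sum>i=1..n. 1 - of_bool (\<pi> i <\<^sub>r \<pi> (i - 1)))"
    by (intro sum.cong) (auto simp: ascent_def)
  also have "\<dots> = int n - int (des_B n \<pi>)"
    by (simp only: sum_subtractf des_B_eq_sum) simp
  finally show ?thesis by (simp add: ascent_def)
qed

text \<open>For fixed \<open>j\<close>, summation by parts over \<open>i\<close> moves the
  difference from \<open>w\<close> to \<open>z\<close>, where \<open>zM\<close> turns the mixed
  difference into \<open>M i j - M i (j - 1)\<close>. For fixed \<open>i\<close>, summation by parts
  over \<open>j\<close> moves this difference to \<open>w\<close>, where \<open>wM\<close> gives
  \<open>M\<close> once more. Both boundary terms vanish and the two minus signs cancel.\<close>

lemma correlation_sum: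
  fixes w z M :: "nat \<Rightarrow> nat \<Rightarrow> int"
  assumes w0: "\<And>j. j \<in> {1..n+1} \<Longrightarrow> w 0 j = 0" "\<And>j. j \<in> {1..n+1} \<Longrightarrow> w (n + 1) j = 0"
    and wM: "\<And>i j. i \<in> {1..n} \<Longrightarrow> j \<in> {1..n} \<Longrightarrow> w i (j + 1) - w i j = M i j"
    and zM: "\<And>i j. i \<in> {1..n} \<Longrightarrow> j \<in> {0..n+1} \<Longrightarrow> z j (i + 1) - z j i = M i j"
    and M0: "\<And>i. i \<in> {1..n} \<Longrightarrow> M i 0 = 0" "\<And>i. i \<in> {1..n} \<Longrightarrow> M i (n + 1) = 0"
  shows "(\<Sum>i=1..n+1. \<Sum>j=1..n+1. (w i j - w (i - 1) j) * (z j i - z (j - 1) i)) =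
    (\<Sum>i=1..n. \<Sum>j=1..n. M i j * M i j)"
proof -
  have "(\<Sum>i=1..n+1. (w i j - w (i - 1) j) * (z j i - z (j - 1) i)) =
      - (\<Sum>i=1..n. (M i j - M i (j - 1)) * w i j)" if j: "j \<in> {1..n+1}" for j
  proof -
    have "(z j (i + 1) - z (j - 1) (i + 1)) - (z j i - z (j - 1) i) = M i j - M i (j - 1)"
      if "i \<in> {1..n}" for i
    proof -
      \<comment> \<open>For \<open>j = 1\<close> the index \<open>j - 1\<close> is 0, which is why
        \<open>zM\<close> includes that value.\<close>
      have "j \<in> {0..n+1}" "j - 1 \<in> {0..n+1}" using j by auto
      from this[THEN zM[OF that]] show ?thesis by linarith
    qed
    then show ?thesis
      using w0[OF j]
      by (simp only: summation_by_parts[of "\<lambda>i. w i j" "\<lambda>i. z j i - z (j - 1) i" n])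
         (simp add: mult.commute)
  qed
  then have "(\<Sum>i=1..n+1. \<Sum>j=1..n+1. (w i j - w (i - 1) j) * (z j i - z (j - 1) i)) =
      (\<Sum>j=1..n+1. - (\<Sum>i=1..n. (M i j - M i (j - 1)) * w i j))"
    by (subst sum.swap) (rule sum.cong[OF refl])
  also have "\<dots> = - (\<Sum>i=1..n. \<Sum>j=1..n+1. (M i j - M i (j - 1)) * w i j)"
    by (simp only: sum_negf) (subst sum.swap, rule refl)
  also have "\<dots> = - (\<Sum>i=1..n. - (\<Sum>j=1..n. M i j * M i j))"
  proof -
    have *: "(\<Sum>j=1..n+1. (M i j - M i (j - 1)) * w i j) = - (\<Sum>j=1..n. M i j * M i j)"
      if i: "i \<in> {1..n}" for i
      using M0[OF i] wM[OF i] by (simp only: summation_by_parts[of "M i" "w i" n]) simp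
    show ?thesis by (rule arg_cong[where f = uminus], rule sum.cong[OF refl], rule *)
  qed
  also have "\<dots> = (\<Sum>i=1..n. \<Sum>j=1..n. M i j * M i j)"
    by (simp add: sum_negf)
  finally show ?thesis .
qed

section \<open>Sums of the changes over the grid\<close>

text \<open>The weights telescope to those at positions 0 and \<open>n + 1\<close>, where \<pi>
  vanishes; hence the sum is the same for every \<open>j\<close>.\<close>

lemma sum_des_change:
  assumes \<pi>: "\<pi> \<in> signed_perms n" and j: "j \<ge> 1"
  shows "(\<Sum>i=1..n+1. des_change c n \<pi> i j) = int n - int (des_B n \<pi>) + of_bool (c = -1)"
proof -
  have "(\<Sum>i=1..n+1. des_change c n \<pi> i j) = (\<Sum>i=1..n+1. ascent c n \<pi> i) +
      (\<Sum>i=1..n+1. weight c j (\<pi> i) - weight c j (\<pi> (i - 1)))"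
    by (simp only: des_change_def sum.distrib[symmetric] add_diff_eq)
  then show ?thesis
    using signed_perms_outside[OF \<pi>, of 0] signed_perms_outside[OF \<pi>, of "n + 1"] weight_0[OF j]
    by (simp only: sum_ascent sum_diff_telescope[of "\<lambda>i. weight c j (\<pi> i)"]) simp
qed

definition sign_count :: "int \<Rightarrow> nat \<Rightarrow> (nat \<Rightarrow> int) \<Rightarrow> nat" where
  "sign_count c n \<pi> = card {i \<in> {1..n}. sgn (\<pi> i) = c}"

lemma sum_des_change_product:
  assumes \<pi>: "\<pi> \<in> signed_perms n" and c: "c = 1 \<or> c = -1"
  shows "(\<Sum>i=1..n+1. \<Sum>j=1..n+1. des_change c n \<pi> i j * des_change c n (sp_inverse n \<pi>) j i) =
    (int n - int (des_B n \<pi>) + of_bool (c = -1)) * (int n - int (ides_B n \<pi>) + of_bool (c = -1)) +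
    int (sign_count c n \<pi>)"
proof -
  define \<tau> where "\<tau> = sp_inverse n \<pi>"
  have \<tau>: "\<tau> \<in> signed_perms n" unfolding \<tau>_def using \<pi> by (rule sp_inverse_signed_perms)
  let ?N = "{1..n+1}"
  define C where "C = ascent c n \<pi>"
  define E where "E = ascent c n \<tau>"
  define w where "w = (\<lambda>i j. weight c j (\<pi> i))"
  define z where "z = (\<lambda>j i. weight c i (\<tau> j))"
  \<comment> \<open>The permutation matrix of \<pi> restricted to the entries of sign
    \<open>c\<close>.\<close>
  define M where "M = (\<lambda>i j. of_bool (\<pi> i = c * int j) :: int)"
  define p where "p = (\<lambda>i j. w i j - w (i - 1) j)"
  define q where "q = (\<lambda>i j. z j i - z (j - 1) i)"
  have w0: "w 0 j = 0" "w (n + 1) j = 0" if "j \<in> ?N" for j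
    using that signed_perms_outside[OF \<pi>] by (auto simp: w_def weight_0)
  have z0: "z 0 i = 0" "z (n + 1) i = 0" if "i \<in> ?N" for i
    using that signed_perms_outside[OF \<tau>] by (auto simp: z_def weight_0)
  have p0: "(\<Sum>i\<in>?N. p i j) = 0" if "j \<in> ?N" for j
    using w0[OF that] by (simp only: p_def sum_diff_telescope[of "\<lambda>i. w i j"])
  have q0: "(\<Sum>j\<in>?N. q i j) = 0" if "i \<in> ?N" for i
    using z0[OF that] by (simp only: q_def sum_diff_telescope[of "\<lambda>j. z j i"])
  have abs: "1 \<le> \<bar>\<pi> i\<bar>" "\<bar>\<pi> i\<bar> \<le> int n" if "i \<in> {1..n}" for i
    using signed_perms_abs_mem[OF \<pi> that] by auto
  have M0: "M i 0 = 0" "M i (n + 1) = 0" if "i \<in> {1..n}" for i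
    using abs[OF that] c by (auto simp: M_def)
  have wM: "w i (j + 1) - w i j = M i j" if "i \<in> {1..n}" "j \<in> {1..n}" for i j
    using that weight_Suc_diff[OF c] by (simp add: w_def M_def)
  \<comment> \<open>For \<open>j \<ge> 1\<close> the increment indicates
    \<open>\<tau> j = c * int i\<close>, which is the same condition as
    \<open>\<pi> i = c * int j\<close>. For \<open>j = 0\<close> both sides are 0.\<close>
  have zM: "z j (i + 1) - z j i = M i j" if i: "i \<in> {1..n}" and j: "j \<in> {0..n+1}" for i j
  proof (cases "j = 0")
    case True
    then show ?thesis using i M0 z0(1)[of i] z0(1)[of "i + 1"] by simp
  next
    case False
    then show ?thesis
      using i weight_Suc_diff[OF c] sp_inverse_eq_iff[OF \<pi> c i] by (simp add: z_def M_def \<tau>_def)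
  qed
  \<comment> \<open>Row \<open>i\<close> of \<open>M\<close> has a single 1, in column
    \<open>nat \<bar>\<pi> i\<bar>\<close>, if \<pi> has sign \<open>c\<close> there, and is zero
    otherwise.\<close>
  have "(\<Sum>j=1..n. M i j * M i j) = of_bool (sgn (\<pi> i) = c)" if i: "i \<in> {1..n}" for i
  proof -
    have "M i j * M i j = (if j = nat \<bar>\<pi> i\<bar> then of_bool (sgn (\<pi> i) = c) else 0)"
      if "j \<in> {1..n}" for j
      using that c by (auto simp: M_def sgn_if split: if_splits)
    then have "(\<Sum>j=1..n. M i j * M i j) =
        (\<Sum>j=1..n. if j = nat \<bar>\<pi> i\<bar> then of_bool (sgn (\<pi> i) = c) else 0)"
      by (rule sum.cong[OF refl])
    also have "\<dots> = of_bool (sgn (\<pi> i) = c)"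
      using signed_perms_abs_mem[OF \<pi> i] by (simp only: sum.delta finite_atLeastAtMost if_True)
    finally show ?thesis .
  qed
  then have "(\<Sum>i=1..n. \<Sum>j=1..n. M i j * M i j) = (\<Sum>i=1..n. of_bool (sgn (\<pi> i) = c))"
    by (rule sum.cong[OF refl])
  also have "\<dots> = int (sign_count c n \<pi>)"
    by (simp add: sign_count_def Int_def)
  finally have MM: "(\<Sum>i=1..n. \<Sum>j=1..n. M i j * M i j) = int (sign_count c n \<pi>)" .
  have pq: "(\<Sum>i\<in>?N. \<Sum>j\<in>?N. p i j * q i j) = int (sign_count c n \<pi>)"
    using correlation_sum[of n w M z, OF w0 wM zM M0] unfolding MM by (simp only: p_def q_def)
  have "(\<Sum>i\<in>?N. \<Sum>j\<in>?N. des_change c n \<pi> i j * des_change c n \<tau> j i) =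
      (\<Sum>i\<in>?N. \<Sum>j\<in>?N. C i * E j + C i * q i j + p i j * E j + p i j * q i j)"
    by (simp only: des_change_def C_def E_def p_def q_def w_def z_def) (simp only: algebra_simps)
  \<comment> \<open>The mixed terms are arranged so that the inner sums are \<open>q0\<close> and
    \<open>p0\<close>, which vanish.\<close>
  also have "\<dots> = (\<Sum>i\<in>?N. \<Sum>j\<in>?N. C i * E j) + (\<Sum>i\<in>?N. C i * (\<Sum>j\<in>?N. q i j)) +
      (\<Sum>j\<in>?N. (\<Sum>i\<in>?N. p i j) * E j) + (\<Sum>i\<in>?N. \<Sum>j\<in>?N. p i j * q i j)"
    by (simp only: sum.distrib sum_distrib_left sum_distrib_right
        sum.swap[of "\<lambda>i j. p i j * E j" ?N ?N])
  also have "\<dots> = sum C ?N * sum E ?N + int (sign_count c n \<pi>)"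
    using p0 q0 by (simp only: pq sum_product) simp
  finally show ?thesis
    by (simp only: C_def E_def \<tau>_def sum_ascent ides_B_def)
qed

section \<open>From sums to counts\<close>

text \<open>The four pairs of values have the indicators \<open>f * g\<close>,
  \<open>f * (1 - g)\<close>, \<open>(1 - f) * g\<close> and
  \<open>(1 - f) * (1 - g)\<close>.\<close>

lemma counts_of_0_1_valued:
  fixes f g :: "'a \<Rightarrow> int"
  assumes G: "finite G" and f: "\<forall>x\<in>G. f x \<in> {0, 1}" and g: "\<forall>x\<in>G. g x \<in> {0, 1}"
  shows "int (card {x \<in> G. (f x, g x) = (1, 1)}) = (\<Sum>x\<in>G. f x * g x)"
    and "int (card {x \<in> G. (f x, g x) = (1, 0)}) = sum f G - (\<Sum>x\<in>G. f x * g x)"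
    and "int (card {x \<in> G. (f x, g x) = (0, 1)}) = sum g G - (\<Sum>x\<in>G. f x * g x)"
    and "int (card {x \<in> G. (f x, g x) = (0, 0)}) =
      int (card G) - sum f G - sum g G + (\<Sum>x\<in>G. f x * g x)"
proof -
  have card: "int (card {x \<in> G. P x}) = (\<Sum>x\<in>G. of_bool (P x))" for P
    using G by (simp add: Int_def)
  show "int (card {x \<in> G. (f x, g x) = (1, 1)}) = (\<Sum>x\<in>G. f x * g x)"
    unfolding card using f g by (intro sum.cong) force+
  show "int (card {x \<in> G. (f x, g x) = (1, 0)}) = sum f G - (\<Sum>x\<in>G. f x * g x)"
    unfolding card sum_subtractf[symmetric] using f g by (intro sum.cong) force+
  show "int (card {x \<in> G. (f x, g x) = (0, 1)}) = sum g G - (\<Sum>x\<in>G. f x * g x)"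
    unfolding card sum_subtractf[symmetric] using f g by (intro sum.cong) force+
  have "int (card G) = (\<Sum>x\<in>G. 1)" by simp
  then show "int (card {x \<in> G. (f x, g x) = (0, 0)}) =
      int (card G) - sum f G - sum g G + (\<Sum>x\<in>G. f x * g x)"
    unfolding card by (simp only: sum_subtractf[symmetric] sum.distrib[symmetric])
      (use f g in \<open>intro sum.cong; force\<close>)
qed

text \<open>Lowering both descent numbers by 1 when \<open>c = -1\<close> absorbs the term
  \<open>of_bool (c = -1)\<close> of the sums, so the same formulas serve both signs.\<close>

lemma change_type_counts:
  fixes c d e k :: int
  assumes \<pi>: "\<pi> \<in> signed_perms n" and c: "c = 1 \<or> c = -1"
    and d: "d = int (des_B n \<pi>) - of_bool (c = -1)"
    and e: "e = int (ides_B n \<pi>) - of_bool (c = -1)"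
    and k: "k = int (sign_count c n \<pi>)"
  defines "change \<equiv> \<lambda>(i, j). (des_change c n \<pi> i j, des_change c n (sp_inverse n \<pi>) j i)"
  shows "int (card {p \<in> grid_points n. change p = (1, 1)}) = (int n - d) * (int n - e) + k"
    and "int (card {p \<in> grid_points n. change p = (1, 0)}) = (e + 1) * (int n - d) - k"
    and "int (card {p \<in> grid_points n. change p = (0, 1)}) = (d + 1) * (int n - e) - k"
    and "int (card {p \<in> grid_points n. change p = (0, 0)}) = (d + 1) * (e + 1) + k"
proof -
  let ?N = "{1..n+1}"
  define f where "f = (\<lambda>(i, j). des_change c n \<pi> i j)"
  define g where "g = (\<lambda>(i, j). des_change c n (sp_inverse n \<pi>) j i)"
  note \<tau> = sp_inverse_signed_perms[OF \<pi>]
  have change: "change p = (f p, g p)" for p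
    by (simp add: change_def f_def g_def split: prod.split)
  have f01: "\<forall>p\<in>grid_points n. f p \<in> {0, 1}"
    using des_change_0_or_1[OF \<pi> c] by (simp add: f_def grid_points_def)
  have g01: "\<forall>p\<in>grid_points n. g p \<in> {0, 1}"
    using des_change_0_or_1[OF \<tau> c] by (simp add: g_def grid_points_def)
  \<comment> \<open>Summing over \<open>i\<close> first makes the inner sums telescope; for
    \<open>g\<close> the roles of \<open>i\<close> and \<open>j\<close> are exchanged.\<close>
  have "sum f (grid_points n) = (\<Sum>j\<in>?N. \<Sum>i\<in>?N. des_change c n \<pi> i j)"
    unfolding f_def grid_points_def by (subst sum.swap) (simp only: sum.cartesian_product)
  also have "\<dots> = (\<Sum>j\<in>?N. int n - d)"
    by (intro sum.cong refl) (use sum_des_change[OF \<pi>] in \<open>simp add: d\<close>)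
  finally have sf: "sum f (grid_points n) = (int n + 1) * (int n - d)" by simp
  have "sum g (grid_points n) = (\<Sum>i\<in>?N. \<Sum>j\<in>?N. des_change c n (sp_inverse n \<pi>) j i)"
    unfolding g_def grid_points_def by (simp only: sum.cartesian_product)
  also have "\<dots> = (\<Sum>i\<in>?N. int n - e)"
    by (intro sum.cong refl) (use sum_des_change[OF \<tau>] in \<open>simp add: e ides_B_def\<close>)
  finally have sg: "sum g (grid_points n) = (int n + 1) * (int n - e)" by simp
  have "(\<Sum>p\<in>grid_points n. f p * g p) =
      (\<Sum>i\<in>?N. \<Sum>j\<in>?N. des_change c n \<pi> i j * des_change c n (sp_inverse n \<pi>) j i)"
    unfolding grid_points_def sum.cartesian_product
    by (intro sum.cong) (auto simp: f_def g_def)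
  also have "\<dots> = (int n - d) * (int n - e) + k"
    by (simp only: sum_des_change_product[OF \<pi> c]) (simp add: d e k algebra_simps)
  finally have sfg: "(\<Sum>p\<in>grid_points n. f p * g p) = (int n - d) * (int n - e) + k" .
  have fin: "finite (grid_points n)" and
    cG: "int (card (grid_points n)) = (int n + 1) * (int n + 1)"
    by (simp_all add: grid_points_def card_cartesian_product algebra_simps)
  note counts = counts_of_0_1_valued[of "grid_points n" f g, OF fin f01 g01]
  show "int (card {p \<in> grid_points n. change p = (1, 1)}) = (int n - d) * (int n - e) + k"
    unfolding change counts sfg by simp
  show "int (card {p \<in> grid_points n. change p = (1, 0)}) = (e + 1) * (int n - d) - k"
    unfolding change counts sfg sf by (simp add: algebra_simps)
  show "int (card {p \<in> grid_points n. change p = (0, 1)}) = (d + 1) * (int n - e) - k"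
    unfolding change counts sfg sg by (simp add: algebra_simps)
  show "int (card {p \<in> grid_points n. change p = (0, 0)}) = (d + 1) * (e + 1) + k"
    unfolding change counts sfg sf sg cG by (simp add: algebra_simps)
qed

section \<open>The d-types of the grid points\<close>

lemma insert_des_ides_change:
  assumes \<pi>: "\<pi> \<in> signed_perms n" and c: "c = 1 \<or> c = -1"
    and i: "i \<in> {1..n+1}" and j: "j \<in> {1..n+1}"
  shows "int (des_B (n + 1) (signed_insert c i j \<pi>)) - int (des_B n \<pi>) = des_change c n \<pi> i j"
    and "int (ides_B (n + 1) (signed_insert c i j \<pi>)) - int (ides_B n \<pi>) =
      des_change c n (sp_inverse n \<pi>) j i"
  using des_B_signed_insert[OF \<pi> c i] des_B_signed_insert[OF sp_inverse_signed_perms[OF \<pi>] c j] i j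
  unfolding ides_B_def sp_inverse_signed_insert[OF assms] by simp_all

lemma d_plus_eq:
  assumes "\<pi> \<in> signed_perms n" "p \<in> grid_points n"
  shows "d_plus n \<pi> p =
    (case p of (i, j) \<Rightarrow> (des_change 1 n \<pi> i j, des_change 1 n (sp_inverse n \<pi>) j i))"
  using assms insert_des_ides_change[OF assms(1), of 1]
  by (auto simp: d_plus_def grid_points_def phi_eq_signed_insert)

lemma d_minus_eq:
  assumes "\<pi> \<in> signed_perms n" "p \<in> grid_points n"
  shows "d_minus n \<pi> p =
    (case p of (i, j) \<Rightarrow> (des_change (-1) n \<pi> i j, des_change (-1) n (sp_inverse n \<pi>) j i))"
  using assms insert_des_ides_change[OF assms(1), of "-1"]
  by (auto simp: d_minus_def grid_points_def phi_bar_eq_signed_insert)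

lemma sign_count_minus_one: "sign_count (-1) n \<pi> = neg_count n \<pi>"
  unfolding sign_count_def neg_count_def
  by (intro arg_cong[where f = card]) (auto simp: sgn_if split: if_splits)

text \<open>No entry at a position in \<open>{1..n}\<close> is 0, so the positive and the negative
  entries account for all \<open>n\<close> positions.\<close>

lemma sign_count_one:
  assumes "\<pi> \<in> signed_perms n"
  shows "int (sign_count 1 n \<pi>) = int n - int (neg_count n \<pi>)"
proof -
  have "{i \<in> {1..n}. sgn (\<pi> i) = 1} \<union> {i \<in> {1..n}. \<pi> i < 0} = {1..n}"
    using signed_perms_abs_mem[OF assms] by (force simp: sgn_if)
  moreover have "{i \<in> {1..n}. sgn (\<pi> i) = 1} \<inter> {i \<in> {1..n}. \<pi> i < 0} = {}"
    by (auto simp: sgn_if)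
  ultimately have "n = sign_count 1 n \<pi> + neg_count n \<pi>"
    unfolding sign_count_def neg_count_def
    by (metis (no_types, lifting) card_Un_disjoint card_atLeastAtMost diff_Suc_1
        finite_Un finite_atLeastAtMost)
  then show ?thesis by simp
qed

theorem theorem6p8:
  fixes n :: nat and \<pi> :: "nat \<Rightarrow> int" and d e m :: int
  assumes "\<pi> \<in> signed_perms n"
    and "d = int (des_B n \<pi>)"
    and "e = int (ides_B n \<pi>)"
    and "m = int (neg_count n \<pi>)"
  shows
    "int (card {p \<in> grid_points n. d_plus n \<pi> p = (0, 0)}) = (d + 1) * (e + 1) - m + int n \<and>
     int (card {p \<in> grid_points n. d_plus n \<pi> p = (1, 0)}) = (e + 1) * (int n - d) + m - int n \<and>
     int (card {p \<in> grid_points n. d_plus n \<pi> p = (0, 1)}) = (d + 1) * (int n - e) + m - int n \<and>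
     int (card {p \<in> grid_points n. d_plus n \<pi> p = (1, 1)}) = (int n - d) * (int n - e) - m + int n \<and>
     int (card {p \<in> grid_points n. d_minus n \<pi> p = (0, 0)}) = d * e + m \<and>
     int (card {p \<in> grid_points n. d_minus n \<pi> p = (1, 0)}) = e * (int n - d + 1) - m \<and>
     int (card {p \<in> grid_points n. d_minus n \<pi> p = (0, 1)}) = d * (int n - e + 1) - m \<and>
     int (card {p \<in> grid_points n. d_minus n \<pi> p = (1, 1)}) = (int n - d + 1) * (int n - e + 1) + m"
proof -
  have plus: "{p \<in> grid_points n. d_plus n \<pi> p = t} = {p \<in> grid_points n.
      (case p of (i, j) \<Rightarrow> (des_change 1 n \<pi> i j, des_change 1 n (sp_inverse n \<pi>) j i)) = t}" for t
    using d_plus_eq[OF assms(1)] by auto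
  have minus: "{p \<in> grid_points n. d_minus n \<pi> p = t} = {p \<in> grid_points n.
      (case p of (i, j) \<Rightarrow> (des_change (-1) n \<pi> i j, des_change (-1) n (sp_inverse n \<pi>) j i)) = t}"
    for t
    using d_minus_eq[OF assms(1)] by auto
  have c: "(1::int) = 1 \<or> (1::int) = -1" "(-1::int) = 1 \<or> (-1::int) = -1" by simp_all
  \<comment> \<open>The parameters are \<open>d\<close>, \<open>e\<close> and
    \<open>int n - m\<close> for positive insertions, and \<open>d - 1\<close>, \<open>e - 1\<close>
    and \<open>m\<close> for negative ones.\<close>
  have d: "d = int (des_B n \<pi>) - of_bool ((1::int) = -1)"
      "d - 1 = int (des_B n \<pi>) - of_bool ((-1::int) = -1)"
    and e: "e = int (ides_B n \<pi>) - of_bool ((1::int) = -1)"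
      "e - 1 = int (ides_B n \<pi>) - of_bool ((-1::int) = -1)"
    and k: "int n - m = int (sign_count 1 n \<pi>)" "m = int (sign_count (-1) n \<pi>)"
    using assms by (simp_all add: sign_count_one sign_count_minus_one)
  show ?thesis
    unfolding plus minus change_type_counts[OF assms(1) c(1) d(1) e(1) k(1)]
      change_type_counts[OF assms(1) c(2) d(2) e(2) k(2)]
    by (simp add: algebra_simps)
qed

end
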